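(* Let $g:\mathbb{R}\to\mathbb{R}$ be a derivator, $\mathbb{F}\in\{\mathbb{R},\mathbb{C}\}$ and $\lambda\in\mathbb{F}\setminus\{0\}$. For each $t\in\mathbb{R}$ let $\Omega_t$ be the maximal interval on which the series $\exp_g(\lambda;t)(x)=\sum_{n=0}^\infty\lambda^n\frac{g_{t,n}(x)}{n!}$ converges absolutely. Then for all $t\in\mathbb{R}$, $s\in\Omega_t$ and $x\in\Omega_s$, we have $x\in\Omega_t$ and $$\exp_g(\lambda;t)(s)\,\exp_g(\lambda;s)(x)=\exp_g(\lambda;t)(x).$$
   Context: A derivator is a left-continuous non-decreasing function $g:\mathbb{R}\to\mathbb{R}$. $\mu_g$ denotes its Lebesgue–Stieltjes measure, characterized on Borel sets by $\mu_g([a,b))=g(b)-g(a)$ for $a<b$. $g$-monomials centered at $t\in\mathbb{R}$: $g_{t,0}\equiv 1$ and, for $n\ge 1$, $g_{t,n}(x)=n\int_{[t,x)}g_{t,n-1}\,d\mu_g$ if $x\ge t$ and $g_{t,n}(x)=-n\int_{[x,t)}g_{t,n-1}\,d\mu_g$ if $x<t$. *)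

theory Defs
  imports "HOL-Analysis.Analysis"
begin

definition derivator :: "(real \<Rightarrow> real) \<Rightarrow> bool" where
  "derivator g \<longleftrightarrow> mono g \<and> (\<forall>x. continuous (at_left x) g)"

text \<open>
  The library's \<^const>\<open>interval_measure\<close> is for right-continuous functions and half-open
  intervals \<open>{a<..b}\<close>. The measure of a left-continuous \<open>g\<close> is obtained by reflecting the one
  of the right-continuous function \<open>\<lambda>x. - g (- x)\<close>; the lemma \<open>emeasure_stieltjes_measure\<close>
  gives its characterizing values.
\<close>

definition stieltjes_measure :: "(real \<Rightarrow> real) \<Rightarrow> real measure" where
  "stieltjes_measure g = distr (interval_measure (\<lambda>x. - g (- x))) borel uminus"

lemma sets_stieltjes_measure [simp, measurable_cong]: "sets (stieltjes_measure g) = sets borel"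
  by (simp add: stieltjes_measure_def)

lemma space_stieltjes_measure [simp]: "space (stieltjes_measure g) = UNIV"
  by (simp add: stieltjes_measure_def)

lemma emeasure_stieltjes_measure:
  assumes "derivator g" and "a \<le> b"
  shows "emeasure (stieltjes_measure g) {a..<b} = ennreal (g b - g a)"
proof -
  let ?F = "\<lambda>x. - g (- x)"
  have mono_F: "?F x \<le> ?F y" if "x \<le> y" for x y
    using assms(1) that by (simp add: derivator_def monoD)
  have cont_F: "continuous (at_right x) ?F" for x
  proof -
    have "(g \<longlongrightarrow> g (- x)) (at_left (- x))"
      using assms(1) by (auto simp: derivator_def continuous_within)
    then have "((\<lambda>y. g (- y)) \<longlongrightarrow> g (- x)) (at_right x)"
      by (simp add: filterlim_at_left_to_right)
    then show ?thesis
      by (auto simp: continuous_within intro: tendsto_minus)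
  qed
  have "uminus -` {a..<b} = {- b<..- a}"
    by auto
  then have "emeasure (stieltjes_measure g) {a..<b} = emeasure (interval_measure ?F) {- b<..- a}"
    by (simp add: stieltjes_measure_def emeasure_distr)
  also have "\<dots> = ennreal (g b - g a)"
    using emeasure_interval_measure_Ioc[of "- b" "- a" ?F] mono_F cont_F assms(2) by simp
  finally show ?thesis .
qed

primrec g_monomial :: "(real \<Rightarrow> real) \<Rightarrow> real \<Rightarrow> nat \<Rightarrow> real \<Rightarrow> real" where
  "g_monomial g t 0 = (\<lambda>x. 1)"
| "g_monomial g t (Suc n) = (\<lambda>x.
     if t \<le> x then real (Suc n) * (LINT y:{t..<x}|stieltjes_measure g. g_monomial g t n y)
     else - real (Suc n) * (LINT y:{x..<t}|stieltjes_measure g. g_monomial g t n y))"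

text \<open>
  The scalar field \<open>\<real>\<close> or \<open>\<complex>\<close> is a type of the classes \<^class>\<open>real_normed_field\<close> and
  \<^class>\<open>banach\<close>; up to isometric isomorphism there are no other such types.
\<close>

definition exp_g_term ::
    "(real \<Rightarrow> real) \<Rightarrow> 'a::{real_normed_field,banach} \<Rightarrow> real \<Rightarrow> real \<Rightarrow> nat \<Rightarrow> 'a" where
  "exp_g_term g l t x n = l ^ n * (of_real (g_monomial g t n x) / fact n)"

definition exp_g ::
    "(real \<Rightarrow> real) \<Rightarrow> 'a::{real_normed_field,banach} \<Rightarrow> real \<Rightarrow> real \<Rightarrow> 'a" where
  "exp_g g l t x = (\<Sum>n. exp_g_term g l t x n)"

text \<open>
  At \<open>x = t\<close> the series is \<open>1 + 0 + 0 + \<dots>\<close>, so the maximal interval contains the centre \<open>t\<close>.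
  The intervals containing \<open>t\<close> on which the series converges absolutely are closed under unions,
  so there is a greatest one. Intervals may be of any kind (open, closed, half-open, degenerate,
  unbounded).
\<close>

definition exp_g_dom ::
    "(real \<Rightarrow> real) \<Rightarrow> 'a::{real_normed_field,banach} \<Rightarrow> real \<Rightarrow> real set" where
  "exp_g_dom g l t =
     \<Union>{I. is_interval I \<and> t \<in> I \<and> (\<forall>x\<in>I. summable (\<lambda>n. norm (exp_g_term g l t x n)))}"

lemma summable_exp_g_term_centre: "summable (\<lambda>n. norm (exp_g_term g l t t n))"
proof (rule summable_finite[of "{0}"])
  show "norm (exp_g_term g l t t n) = 0" if "n \<notin> {0}" for n
    using that by (cases n) (auto simp: exp_g_term_def set_lebesgue_integral_def)
qed simp

lemma exp_g_dom_maximal: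
  shows "is_interval (exp_g_dom g l t)"
    and "t \<in> exp_g_dom g l t"
    and "x \<in> exp_g_dom g l t \<Longrightarrow> summable (\<lambda>n. norm (exp_g_term g l t x n))"
    and "\<lbrakk>is_interval I; t \<in> I; \<And>x. x \<in> I \<Longrightarrow> summable (\<lambda>n. norm (exp_g_term g l t x n))\<rbrakk>
           \<Longrightarrow> I \<subseteq> exp_g_dom g l t"
proof -
  show "is_interval (exp_g_dom g l t)"
    unfolding exp_g_dom_def is_interval_connected_1
    by (rule connected_Union) (auto simp: is_interval_connected_1)
  have "is_interval {t}" by (simp add: is_interval_connected_1)
  then show "t \<in> exp_g_dom g l t"
    using summable_exp_g_term_centre[of g l t] by (auto simp: exp_g_dom_def intro!: exI[of _ "{t}"])
qed (auto simp: exp_g_dom_def)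

end

(* The normalised monomials h_n = g_{t,n} / n! are iterated oriented integrals of 1. Additivity of
   the oriented integral in its limits gives, by induction on n, the convolution identity
   h_n(t, x) = (\<Sum>k\<le>n. h_k(t, s) * h_{n-k}(s, x)), for t, s, x in any order. Hence the Cauchy product of
   the series centred at t (evaluated at s) and at s (evaluated at x) is the series centred at t
   evaluated at x, and Mertens' theorem yields both the value and absolute convergence. Since
   \<Omega>_t and \<Omega>_s share the point s, their union is an interval, whence \<Omega>_s \<subseteq> \<Omega>_t. *)

theory Submission
  imports Defs
begin

text \<open>The Stieltjes counterpart of the integral from \<open>a\<close> to \<open>b\<close>,
  with the sign convention of \<open>g_monomial\<close>. The intervals stay closed on the left and
  open on the right in both directions, so that an atom of \<open>M\<close> at a common endpoint is
  counted exactly once.\<close>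

definition oriented_integral :: "real measure \<Rightarrow> (real \<Rightarrow> real) \<Rightarrow> real \<Rightarrow> real \<Rightarrow> real" where
  "oriented_integral M f a b =
     (if a \<le> b then LINT y:{a..<b}|M. f y else - (LINT y:{b..<a}|M. f y))"

lemma oriented_integral_combine:
  assumes f: "\<And>a b. set_integrable M {a..<b} f"
  shows "oriented_integral M f a b + oriented_integral M f b c = oriented_integral M f a c"
proof -
  have *: "(LINT y:{a..<c}|M. f y) = (LINT y:{a..<b}|M. f y) + (LINT y:{b..<c}|M. f y)"
    if "a \<le> b" "b \<le> c" for a b c
  proof -
    have "{a..<c} = {a..<b} \<union> {b..<c}" "{a..<b} \<inter> {b..<c} = {}"
      using that by auto
    then show ?thesis
      using f by (simp add: set_integral_Un)
  qed
  show ?thesis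
    \<comment> \<open>One instance for each of the six possible orders of the three points.\<close>
    using *[of a b c] *[of a c b] *[of b a c] *[of b c a] *[of c a b] *[of c b a]
    by (auto simp: oriented_integral_def)
qed

lemma oriented_integral_sum:
  assumes "\<And>i a b. i \<in> I \<Longrightarrow> set_integrable M {a..<b} (f i)"
  shows "oriented_integral M (\<lambda>y. \<Sum>i\<in>I. c i * f i y) a b
           = (\<Sum>i\<in>I. c i * oriented_integral M (f i) a b)"
proof -
  have "(LINT y:{a..<b}|M. \<Sum>i\<in>I. c i * f i y) = (\<Sum>i\<in>I. c i * (LINT y:{a..<b}|M. f i y))"
    for a b
  proof -
    have "(LINT y:{a..<b}|M. \<Sum>i\<in>I. c i * f i y)
        = (LINT y|M. (\<Sum>i\<in>I. c i * (indicator {a..<b} y * f i y)))"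
      unfolding set_lebesgue_integral_def
      by (intro Bochner_Integration.integral_cong refl) (simp add: sum_distrib_left mult.left_commute)
    also have "\<dots> = (\<Sum>i\<in>I. (LINT y|M. c i * (indicator {a..<b} y * f i y)))"
    proof (rule Bochner_Integration.integral_sum)
      show "integrable M (\<lambda>y. c i * (indicator {a..<b} y * f i y))" if "i \<in> I" for i
        using assms[OF that, of a b] by (simp add: set_integrable_def)
    qed
    finally show ?thesis
      by (simp add: set_lebesgue_integral_def)
  qed
  then show ?thesis
    by (simp add: oriented_integral_def sum_negf)
qed

text \<open>Moving the limits of integration into the integrand as a condition turns this into an
  integral depending on a parameter, with a jointly measurable integrand; sigma-finiteness then
  gives measurability in the parameter.\<close>

lemma measurable_oriented_integral:
  assumes "sigma_finite_measure M" and [measurable_cong]: "sets M = sets borel"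
    and [measurable]: "f \<in> borel_measurable borel"
  shows "oriented_integral M f t \<in> borel_measurable borel"
proof -
  interpret sigma_finite_measure M by fact
  have [measurable]: "(\<lambda>x. LINT y|M. (if a x \<le> y \<and> y < b x then f y else 0)) \<in> borel_measurable borel"
    if [measurable]: "a \<in> borel_measurable borel" "b \<in> borel_measurable borel" for a b :: "real \<Rightarrow> real"
    by measurable
  have "oriented_integral M f t = (\<lambda>x. if t \<le> x then LINT y|M. (if t \<le> y \<and> y < x then f y else 0)
      else - (LINT y|M. (if x \<le> y \<and> y < t then f y else 0)))"
    unfolding oriented_integral_def set_lebesgue_integral_def
    by (intro ext if_cong refl arg_cong[where f = uminus] Bochner_Integration.integral_cong)
       (auto simp: indicator_def)
  also have "\<dots> \<in> borel_measurable borel"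
    by measurable
  finally show ?thesis .
qed

text \<open>A bounded measurable function is integrable over a set of finite measure. This is what
  allows the integral to be iterated.\<close>

lemma set_integrable_oriented_integral:
  assumes "sigma_finite_measure M" and [measurable_cong]: "sets M = sets borel"
    and [measurable]: "f \<in> borel_measurable borel"
    and f: "\<And>a b. set_integrable M {a..<b} f"
    and fin: "\<And>a b. emeasure M {a..<b} < \<infinity>"
  shows "set_integrable M {a..<b} (oriented_integral M f t)"
proof -
  \<comment> \<open>\<open>{c..<d}\<close> contains every interval between \<open>t\<close> and a
    point of \<open>{a..<b}\<close>, so \<open>K\<close> bounds the oriented integral on all of
    \<open>{a..<b}\<close>.\<close>
  define c d where "c = min a t" and "d = max b t"
  define K where "K = (LINT y:{c..<d}|M. \<bar>f y\<bar>)"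
  have sub: "\<bar>LINT y:{u..<v}|M. f y\<bar> \<le> K" if "c \<le> u" "v \<le> d" for u v
  proof -
    have "\<bar>LINT y:{u..<v}|M. f y\<bar> \<le> (LINT y:{u..<v}|M. \<bar>f y\<bar>)"
      using set_integral_norm_bound[OF f[of u v]] by simp
    also have "\<dots> \<le> K"
      unfolding K_def set_lebesgue_integral_def
    proof (rule integral_mono)
      show "integrable M (\<lambda>y. indicat_real {u..<v} y *\<^sub>R \<bar>f y\<bar>)"
           "integrable M (\<lambda>y. indicat_real {c..<d} y *\<^sub>R \<bar>f y\<bar>)"
        using set_integrable_abs[OF f] by (auto simp: set_integrable_def)
    qed (use that in \<open>auto simp: indicator_def\<close>)
    finally show ?thesis .
  qed
  have [measurable]: "oriented_integral M f t \<in> borel_measurable borel"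
    by (rule measurable_oriented_integral) fact+
  show ?thesis
    unfolding set_integrable_def
  proof (rule integrableI_bounded_set[where A = "{a..<b}" and B = K])
    show "AE x in M. x \<in> {a..<b} \<longrightarrow> norm (indicat_real {a..<b} x *\<^sub>R oriented_integral M f t x) \<le> K"
      by (rule AE_I2) (auto simp: oriented_integral_def c_def d_def intro!: sub)
  qed (use fin in auto)
qed

lemma emeasure_stieltjes_measure_finite:
  assumes "derivator g"
  shows "emeasure (stieltjes_measure g) {a..<b} < \<infinity>"
  using emeasure_stieltjes_measure[OF assms, of a b] by (cases "a \<le> b") auto

lemma sigma_finite_stieltjes_measure:
  assumes "derivator g"
  shows "sigma_finite_measure (stieltjes_measure g)"
proof
  have "\<exists>n::nat. x \<in> {- real n..<real n}" for x
  proof -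
    obtain n where "\<bar>x\<bar> < real n"
      using reals_Archimedean2 by blast
    then have "x \<in> {- real n..<real n}" by auto
    then show ?thesis ..
  qed
  then have "(\<Union>n::nat. {- real n..<real n}) = UNIV"
    by blast
  then show "\<exists>A. countable A \<and> A \<subseteq> sets (stieltjes_measure g) \<and> \<Union>A = space (stieltjes_measure g)
      \<and> (\<forall>a\<in>A. emeasure (stieltjes_measure g) a \<noteq> \<infinity>)"
    using emeasure_stieltjes_measure_finite[OF assms]
    by (intro exI[of _ "range (\<lambda>n::nat. {- real n..<real n})"]) (auto simp: less_top)
qed

text \<open>Division by \<open>fact n\<close> absorbs the factor \<open>n\<close> of the recursion
  and removes the binomial coefficients from the addition formula.\<close>

definition normalized_monomial :: "(real \<Rightarrow> real) \<Rightarrow> real \<Rightarrow> nat \<Rightarrow> real \<Rightarrow> real" where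
  "normalized_monomial g t n x = g_monomial g t n x / fact n"

lemma normalized_monomial_0 [simp]: "normalized_monomial g t 0 = (\<lambda>x. 1)"
  by (simp add: normalized_monomial_def fun_eq_iff)

lemma normalized_monomial_Suc:
  "normalized_monomial g t (Suc n) =
     oriented_integral (stieltjes_measure g) (normalized_monomial g t n) t"
  by (rule ext)
    (simp add: normalized_monomial_def[abs_def] oriented_integral_def field_simps del: of_nat_Suc)

text \<open>Both properties go through one induction, since integrability at the next index uses
  measurability at the current one.\<close>

lemma normalized_monomial_regular:
  assumes "derivator g"
  shows "normalized_monomial g t n \<in> borel_measurable borel
    \<and> (\<forall>a b. set_integrable (stieltjes_measure g) {a..<b} (normalized_monomial g t n))"
proof (induction n)
  case 0
  show ?case
    using emeasure_stieltjes_measure_finite[OF assms] by (simp add: set_integrable_def)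
next
  case (Suc n)
  show ?case
    unfolding normalized_monomial_Suc
    using Suc emeasure_stieltjes_measure_finite[OF assms]
    by (auto intro!: measurable_oriented_integral set_integrable_oriented_integral
        sigma_finite_stieltjes_measure[OF assms])
qed

lemma normalized_monomial_convolution:
  assumes "derivator g"
  shows "normalized_monomial g t n x =
    (\<Sum>k\<le>n. normalized_monomial g t k s * normalized_monomial g s (n - k) x)"
proof (induction n arbitrary: x)
  case 0
  show ?case by simp
next
  case (Suc n)
  let ?I = "oriented_integral (stieltjes_measure g)" and ?h = "normalized_monomial g"
  have int: "set_integrable (stieltjes_measure g) {a..<b} (?h r m)" for r m a b
    using normalized_monomial_regular[OF assms] by blast
  \<comment> \<open>The path from \<open>t\<close> to \<open>x\<close> is broken at
    \<open>s\<close>. The first piece is the summand \<open>k = Suc n\<close>; the second yields the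
    summands \<open>k \<le> n\<close> by the induction hypothesis, which is needed at every point
    \<open>y\<close> under the integral.\<close>
  have "?h t (Suc n) x = ?I (?h t n) t s + ?I (?h t n) s x"
    by (simp add: normalized_monomial_Suc oriented_integral_combine int)
  also have "?I (?h t n) s x = ?I (\<lambda>y. \<Sum>k\<le>n. ?h t k s * ?h s (n - k) y) s x"
    by (simp add: Suc[abs_def])
  \<comment> \<open>Only the factor centred at \<open>s\<close> depends on \<open>y\<close>;
    integrating it from \<open>s\<close> raises its index by one.\<close>
  also have "\<dots> = (\<Sum>k\<le>n. ?h t k s * ?h s (Suc n - k) x)"
    by (simp add: oriented_integral_sum int Suc_diff_le normalized_monomial_Suc)
  finally show ?case
    by (simp add: normalized_monomial_Suc)
qed

lemma exp_g_term_convolution: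
  assumes "derivator g"
  shows "exp_g_term g l t x n = (\<Sum>k\<le>n. exp_g_term g l t s k * exp_g_term g l s x (n - k))"
proof -
  have term_eq: "exp_g_term g l u v m = l ^ m * of_real (normalized_monomial g u m v)" for u v m
    by (simp add: exp_g_term_def normalized_monomial_def)
  show ?thesis
    unfolding term_eq normalized_monomial_convolution[OF assms, of t n x s] of_real_sum sum_distrib_left
  proof (intro sum.cong refl)
    fix k assume "k \<in> {..n}"
    then have "l ^ n = l ^ k * l ^ (n - k)"
      by (simp flip: power_add)
    then show "l ^ n * of_real (normalized_monomial g t k s * normalized_monomial g s (n - k) x) =
        l ^ k * of_real (normalized_monomial g t k s) *
        (l ^ (n - k) * of_real (normalized_monomial g s (n - k) x))"
      by simp
  qed
qed

text \<open>The Cauchy product of the norms dominates the norms of the Cauchy product.\<close>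

lemma abs_summable_Cauchy_product:
  fixes a b :: "nat \<Rightarrow> 'a::{real_normed_algebra,banach}"
  assumes "summable (\<lambda>k. norm (a k))" and "summable (\<lambda>k. norm (b k))"
  shows "summable (\<lambda>k. norm (\<Sum>i\<le>k. a i * b (k - i)))"
proof (rule summable_comparison_test')
  show "summable (\<lambda>k. \<Sum>i\<le>k. norm (a i) * norm (b (k - i)))"
    using assms by (intro summable_Cauchy_product) auto
  show "norm (norm (\<Sum>i\<le>k. a i * b (k - i))) \<le> (\<Sum>i\<le>k. norm (a i) * norm (b (k - i)))"
    if "k \<ge> 0" for k
    by (auto intro!: sum_norm_le norm_mult_ineq)
qed

theorem proposition5p5:
  fixes g :: "real \<Rightarrow> real" and l :: "'a::{real_normed_field,banach}"
  assumes "derivator g" and "l \<noteq> 0"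
  shows "\<forall>t. \<forall>s \<in> exp_g_dom g l t. \<forall>x \<in> exp_g_dom g l s.
           x \<in> exp_g_dom g l t \<and> exp_g g l t s * exp_g g l s x = exp_g g l t x"
proof (intro allI ballI conjI)
  fix t s x
  assume s: "s \<in> exp_g_dom g l t" and x: "x \<in> exp_g_dom g l s"
  \<comment> \<open>The centres \<open>t\<close> and \<open>s\<close> are fixed and the evaluation
    point is left free, to be used at any \<open>y\<close> of the second interval and at
    \<open>x\<close>.\<close>
  note conv = exp_g_term_convolution[OF assms(1), of l t _ _ s]
  have "exp_g_dom g l t \<union> exp_g_dom g l s \<subseteq> exp_g_dom g l t"
  proof (rule exp_g_dom_maximal(4))
    have "exp_g_dom g l t \<inter> exp_g_dom g l s \<noteq> {}"
      using s exp_g_dom_maximal(2)[of s g l] by blast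
    then show "is_interval (exp_g_dom g l t \<union> exp_g_dom g l s)"
      using exp_g_dom_maximal(1) unfolding is_interval_connected_1 by (intro connected_Un) auto
    show "t \<in> exp_g_dom g l t \<union> exp_g_dom g l s"
      using exp_g_dom_maximal(2) by blast
    show "summable (\<lambda>n. norm (exp_g_term g l t y n))"
      if "y \<in> exp_g_dom g l t \<union> exp_g_dom g l s" for y
      using that
    proof
      assume "y \<in> exp_g_dom g l s"
      then show ?thesis
        unfolding conv[of y]
        by (intro abs_summable_Cauchy_product exp_g_dom_maximal(3) s)
    qed (rule exp_g_dom_maximal(3))
  qed
  then show "x \<in> exp_g_dom g l t"
    using x by blast
  show "exp_g g l t s * exp_g g l s x = exp_g g l t x"
    unfolding exp_g_def conv[of x] by (intro Cauchy_product exp_g_dom_maximal(3) s x)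
qed

end
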